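(* Let $A$ be a finite set of real numbers. Then the number of triples $(a,b,c)$ with $a,b,c\in A$ and $a-b=2c$ is at most $0.5|A|^2+0.5|A|$. *)

theory Defs
  imports Complex_Main
begin

end

theory Submission
  imports Defs
begin

text \<open>
  Induct on \<open>|A|\<close> by removing an element \<open>m\<close> of maximal absolute value. A solution of
  \<open>a - b = 2 * c\<close> that involves \<open>m\<close> has \<open>a = m\<close> or \<open>b = m\<close>, since \<open>c = m\<close> forces \<open>a = m = - b\<close>.
  For given \<open>c\<close> there is at most one such solution: \<open>m - 2 * c\<close> and \<open>m + 2 * c\<close> can both have
  absolute value at most \<open>|m|\<close> only if \<open>c = 0\<close>, and then the two solutions coincide. So removing
  \<open>m\<close> destroys at most \<open>|A|\<close> solutions.
\<close>

definition diff_double_triples :: "real set \<Rightarrow> (real \<times> real \<times> real) set" where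
  "diff_double_triples A = {(a, b, c). a \<in> A \<and> b \<in> A \<and> c \<in> A \<and> a - b = 2 * c}"

lemma finite_diff_double_triples:
  assumes "finite A"
  shows "finite (diff_double_triples A)"
  by (rule finite_subset[of _ "A \<times> A \<times> A"]) (use assms in \<open>auto simp: diff_double_triples_def\<close>)

lemma card_diff_double_triples_remove_abs_max:
  assumes "finite A" "m \<in> A" and max: "\<And>x. x \<in> A \<Longrightarrow> \<bar>x\<bar> \<le> \<bar>m\<bar>"
  shows "card (diff_double_triples A) \<le> card (diff_double_triples (A - {m})) + card A"
proof -
  define S where "S = {(a, b, c) \<in> diff_double_triples A. a = m \<or> b = m}"
  have "c \<noteq> m" if "a \<in> A" "b \<in> A" "a - b = 2 * c" "a \<noteq> m" for a b c
    using that max[of a] max[of b] by linarith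
  then have split: "diff_double_triples A \<subseteq> diff_double_triples (A - {m}) \<union> S"
    unfolding S_def diff_double_triples_def by blast
  have "S \<subseteq> diff_double_triples A"
    by (auto simp: S_def)
  then have fin: "finite S"
    using finite_diff_double_triples[OF assms(1)] finite_subset by blast
  \<comment> \<open>In the mixed case \<open>a = m\<close>, \<open>b' = m\<close>, adding the
    equations gives \<open>a' + b = 2 * m\<close>. As neither absolute value exceeds that of
    \<open>m\<close>, both \<open>a'\<close> and \<open>b\<close> equal \<open>m\<close>.\<close>
  have coincide: "a = a' \<and> b = b'"
    if "a \<in> A" "b \<in> A" "a' \<in> A" "b' \<in> A" "a - b = 2 * c" "a' - b' = 2 * c"
      "a = m \<or> b = m" "a' = m \<or> b' = m" for a b a' b' c
    using that(5-8) max[OF that(1)] max[OF that(2)] max[OF that(3)] max[OF that(4)]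
    by linarith
  \<comment> \<open>Projecting to \<open>c\<close> embeds the lost triples into
    \<open>A\<close>.\<close>
  have "inj_on (snd \<circ> snd) S"
  proof (rule inj_onI)
    fix s t assume "s \<in> S" "t \<in> S" "(snd \<circ> snd) s = (snd \<circ> snd) t"
    then obtain a b a' b' c where "s = (a, b, c)" "t = (a', b', c)"
      by (cases s; cases t) auto
    with \<open>s \<in> S\<close> \<open>t \<in> S\<close> coincide[of a b a' b' c] show "s = t"
      by (auto simp: S_def diff_double_triples_def)
  qed
  moreover have "(snd \<circ> snd) ` S \<subseteq> A"
    by (auto simp: S_def diff_double_triples_def)
  ultimately have "card S \<le> card A"
    using card_inj_on_le \<open>finite A\<close> by blast
  moreover have "card (diff_double_triples A) \<le> card (diff_double_triples (A - {m}) \<union> S)"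
    using split fin finite_diff_double_triples assms(1) by (intro card_mono) auto
  ultimately show ?thesis
    using card_Un_le[of "diff_double_triples (A - {m})" S] by linarith
qed

text \<open>The losses sum to at most 1 + 2 + ... + \<open>card A\<close>; doubling avoids division
  in the naturals.\<close>

lemma card_diff_double_triples_le:
  assumes "finite A"
  shows "2 * card (diff_double_triples A) \<le> card A * (card A + 1)"
  using assms
proof (induction "card A" arbitrary: A)
  case 0
  then have "diff_double_triples A = {}"
    by (auto simp: diff_double_triples_def)
  then show ?case
    by simp
next
  case (Suc n)
  then have "A \<noteq> {}"
    by auto
  then have "Max (abs ` A) \<in> abs ` A"
    using Suc.prems by (intro Max_in) auto
  then obtain m where m: "m \<in> A" "\<bar>m\<bar> = Max (abs ` A)"
    by force
  have max: "\<bar>x\<bar> \<le> \<bar>m\<bar>" if "x \<in> A" for x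
    using that Suc.prems m(2) by simp
  have "card (A - {m}) = n"
    using Suc m(1) by (simp add: card_Diff_singleton flip: Suc.hyps(2))
  then have "2 * card (diff_double_triples (A - {m})) \<le> n * (n + 1)"
    using Suc.hyps(1)[of "A - {m}"] Suc.prems by simp
  \<comment> \<open>The bound closes because
    \<open>n * (n + 1) + 2 * (n + 1) = (n + 1) * (n + 2)\<close>.\<close>
  with card_diff_double_triples_remove_abs_max[OF Suc.prems m(1) max] show ?case
    by (simp flip: Suc.hyps(2))
qed

theorem theorem2:
  fixes A :: "real set"
  assumes "finite A"
  shows "real (card {(a, b, c). a \<in> A \<and> b \<in> A \<and> c \<in> A \<and> a - b = 2 * c})
           \<le> 0.5 * (real (card A))\<^sup>2 + 0.5 * real (card A)"
proof -
  have "real (2 * card (diff_double_triples A)) \<le> real (card A * (card A + 1))"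
    using card_diff_double_triples_le[OF assms] of_nat_le_iff by blast
  then show ?thesis
    by (simp add: diff_double_triples_def power2_eq_square algebra_simps)
qed

end
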